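(* Let $(A,+)$ be a non-trivial finite abelian group, let $k>1$, and let $\mathcal{B}(k,A)=\mathcal{G}(\mathcal{M}(\mathcal{B}_k(A),\chi_k(A)))$. Then $\mathcal{B}(k,A)$ is isomorphic to the wreath product $A^k\wr\mathbb{Z}$.
   Context: The De Bruijn automaton $\mathcal{B}_k(A)=(Q,A,\delta)$ has state set $Q=A^k$ (words of length $k$ over $A$) and transitions $\delta(ys,x)=sx$ for $x,y\in A$, $s\in A^{k-1}$. The coloring $\chi_k(A)$ gives the invertible Mealy automaton $\mathcal{M}=\mathcal{M}(\mathcal{B}_k(A),\chi_k(A))=(Q,A,\delta,\lambda)$ with output function $\lambda(ys,x)=x-y$ for $x,y\in A$, $s\in A^{k-1}$. For $q\in Q$ the bijection $\mathcal{M}_q:A^*\to A^*$ is defined by $\mathcal{M}_q(1)=1$ and $\mathcal{M}_q(a_0a_1\cdots a_n)=\lambda(q,a_0)\,\mathcal{M}_{\delta(q,a_0)}(a_1\cdots a_n)$. $\mathcal{G}(\mathcal{M})$ is the group of bijections of $A^*$ generated by $\{\mathcal{M}_q:q\in Q\}$. Here $A^k\wr\mathbb{Z}$ denotes the restricted wreath product $\left(\bigoplus_{\mathbb{Z}}A^k\right)\rtimes\mathbb{Z}$, where $A^k$ is the direct product of $k$ copies of $A$ and $\mathbb{Z}$ acts by shifting the index set. *)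

theory Defs
  imports "HOL-Algebra.Algebra"
begin

section \<open>Mealy automata and the groups they generate\<close>

record ('q, 'a) automaton =
  states :: "'q set"
  alphabet :: "'a set"
  step :: "'q \<Rightarrow> 'a \<Rightarrow> 'q"

record ('q, 'a) mealy = "('q, 'a) automaton" +
  emit :: "'q \<Rightarrow> 'a \<Rightarrow> 'a"

primrec run :: "('q, 'a, 'm) mealy_scheme \<Rightarrow> 'a list \<Rightarrow> 'q \<Rightarrow> 'a list" where
  "run M [] q = []"
| "run M (a # w) q = emit M q a # run M w (step M q a)"

abbreviation words :: "('q, 'a, 'm) automaton_scheme \<Rightarrow> 'a list set" where
  "words M \<equiv> lists (alphabet M)"

text \<open>The restriction to words over the alphabet makes the map extensional, as the elements
  of \<^const>\<open>BijGroup\<close> are required to be.\<close>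

definition state_map :: "('q, 'a, 'm) mealy_scheme \<Rightarrow> 'q \<Rightarrow> 'a list \<Rightarrow> 'a list" where
  "state_map M q = (\<lambda>w \<in> words M. run M w q)"

definition invertible_mealy :: "('q, 'a, 'm) mealy_scheme \<Rightarrow> bool" where
  "invertible_mealy M \<longleftrightarrow>
     (\<forall>q \<in> states M. (\<forall>a \<in> alphabet M. step M q a \<in> states M) \<and>
                     bij_betw (emit M q) (alphabet M) (alphabet M))"

definition automaton_group :: "('q, 'a, 'm) mealy_scheme \<Rightarrow> ('a list \<Rightarrow> 'a list) monoid" where
  "automaton_group M =
     (BijGroup (words M)) \<lparr>carrier := generate (BijGroup (words M)) (state_map M ` states M)\<rparr>"

lemma run_bij_betw:
  assumes "invertible_mealy M" "q \<in> states M"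
  shows "bij_betw (\<lambda>w. run M w q) (words M) (words M)"
proof -
  have step: "step M q a \<in> states M" and inj: "inj_on (emit M q) (alphabet M)"
    and img: "emit M q ` alphabet M = alphabet M" if "q \<in> states M" "a \<in> alphabet M" for q a
    using assms(1) that unfolding invertible_mealy_def bij_betw_def by blast+
  have inj_run: "v = w" if "v \<in> words M" "w \<in> words M" "run M v q = run M w q" "q \<in> states M"
    for v w q
    using that
  proof (induction v arbitrary: w q rule: list.induct)
    case Nil
    then show ?case by (cases w) auto
  next
    case (Cons a v)
    then obtain b w' where w: "w = b # w'" by (cases w) auto
    have "a \<in> alphabet M" "b \<in> alphabet M"
      using Cons.prems w by simp_all
    then have "a = b"
      using Cons.prems w inj[of q a] by (auto dest: inj_onD)
    then show ?case
      using Cons.IH[of w' "step M q a"] Cons.prems w step[of q a] by auto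
  qed
  have into: "run M w q \<in> words M" if "w \<in> words M" "q \<in> states M" for w q
    using that
  proof (induction w arbitrary: q rule: list.induct)
    case (Cons a w)
    then show ?case using step[of q a] img[of q a] by auto
  qed simp
  have surj_run: "\<exists>v \<in> words M. run M v q = w" if "w \<in> words M" "q \<in> states M" for w q
    using that
  proof (induction w arbitrary: q rule: list.induct)
    case Nil
    then show ?case by (intro bexI[of _ "[]"]) auto
  next
    case (Cons b w)
    then have "b \<in> emit M q ` alphabet M"
      using img[of q b] by simp
    then obtain a where a: "a \<in> alphabet M" "emit M q a = b"
      by blast
    then obtain v where "v \<in> words M" "run M v (step M q a) = w"
      using Cons step[of q a] by auto
    then show ?case
      using a by (intro bexI[of _ "a # v"]) auto
  qed
  show ?thesis
    unfolding bij_betw_def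
  proof (intro conjI inj_onI equalityI subsetI)
    fix w
    assume "w \<in> words M"
    then show "w \<in> (\<lambda>w. run M w q) ` words M"
      using surj_run[of w q] assms(2) by blast
  qed (use inj_run into assms(2) in blast)+
qed

lemma state_map_in_BijGroup:
  assumes "invertible_mealy M" "q \<in> states M"
  shows "state_map M q \<in> carrier (BijGroup (words M))"
  using run_bij_betw[OF assms] bij_betw_cong[of "words M" "state_map M q" "\<lambda>w. run M w q" "words M"]
  by (simp add: BijGroup_def Bij_def state_map_def)

lemma group_automaton_group:
  assumes "invertible_mealy M"
  shows "group (automaton_group M)"
proof -
  interpret B: group "BijGroup (words M)" by (rule group_BijGroup)
  have "subgroup (generate (BijGroup (words M)) (state_map M ` states M)) (BijGroup (words M))"
    using state_map_in_BijGroup[OF assms] by (intro B.generate_is_subgroup) auto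
  then show ?thesis
    unfolding automaton_group_def by (rule B.subgroup_imp_group)
qed


section \<open>De Bruijn automata\<close>

text \<open>The abelian group \<open>A\<close> is a \<^locale>\<open>comm_group\<close>, hence written multiplicatively:
  \<open>x - y\<close> becomes \<open>x \<otimes> inv y\<close>. A state \<open>y s\<close> is a list whose head \<open>y\<close> is its first letter, so
  that \<open>s x\<close> is \<open>tl q @ [x]\<close>.\<close>

definition de_bruijn :: "nat \<Rightarrow> ('a, 'b) monoid_scheme \<Rightarrow> ('a list, 'a) automaton" where
  "de_bruijn k A =
     \<lparr>states = {q \<in> lists (carrier A). length q = k},
      alphabet = carrier A,
      step = (\<lambda>q x. tl q @ [x])\<rparr>"

definition de_bruijn_mealy :: "nat \<Rightarrow> ('a, 'b) monoid_scheme \<Rightarrow> ('a list, 'a) mealy" where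
  "de_bruijn_mealy k A =
     automaton.extend (de_bruijn k A) \<lparr>emit = (\<lambda>q x. x \<otimes>\<^bsub>A\<^esub> inv\<^bsub>A\<^esub> (hd q))\<rparr>"

lemma de_bruijn_mealy_simps [simp]:
  "states (de_bruijn_mealy k A) = {q \<in> lists (carrier A). length q = k}"
  "alphabet (de_bruijn_mealy k A) = carrier A"
  "step (de_bruijn_mealy k A) = (\<lambda>q x. tl q @ [x])"
  "emit (de_bruijn_mealy k A) = (\<lambda>q x. x \<otimes>\<^bsub>A\<^esub> inv\<^bsub>A\<^esub> (hd q))"
  by (simp_all add: de_bruijn_mealy_def de_bruijn_def automaton.defs)

lemma invertible_de_bruijn_mealy:
  assumes "group A" "k > 0"
  shows "invertible_mealy (de_bruijn_mealy k A)"
proof -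
  interpret group A by fact
  have "bij_betw (\<lambda>x. x \<otimes>\<^bsub>A\<^esub> inv\<^bsub>A\<^esub> y) (carrier A) (carrier A)" if "y \<in> carrier A" for y
    by (rule bij_betw_byWitness[where f' = "\<lambda>x. x \<otimes>\<^bsub>A\<^esub> y"]) (use that in \<open>auto simp: m_assoc\<close>)
  moreover have "hd q \<in> carrier A \<and> tl q \<in> lists (carrier A)"
    if "q \<in> lists (carrier A)" "length q = k" for q
    using that assms(2) by (cases q) auto
  ultimately show ?thesis
    using assms(2) by (auto simp: invertible_mealy_def)
qed


section \<open>Restricted wreath products with the integers\<close>

definition semidirect_product ::
  "('n, 'x) monoid_scheme \<Rightarrow> ('h, 'y) monoid_scheme \<Rightarrow> ('h \<Rightarrow> 'n \<Rightarrow> 'n) \<Rightarrow> ('n \<times> 'h) monoid" where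
  "semidirect_product N H \<phi> =
     \<lparr>carrier = carrier N \<times> carrier H,
      monoid.mult = (\<lambda>(n, h) (n', h'). (n \<otimes>\<^bsub>N\<^esub> \<phi> h n', h \<otimes>\<^bsub>H\<^esub> h')),
      one = (\<one>\<^bsub>N\<^esub>, \<one>\<^bsub>H\<^esub>)\<rparr>"

definition shift :: "int \<Rightarrow> (int \<Rightarrow> 'c) \<Rightarrow> int \<Rightarrow> 'c" where
  "shift n f = (\<lambda>i. f (i - n))"

definition int_wreath :: "('c, 'd) monoid_scheme \<Rightarrow> ((int \<Rightarrow> 'c) \<times> int) monoid" where
  "int_wreath N = semidirect_product (sum_group UNIV (\<lambda>_. N)) integer_group shift"

definition direct_power :: "('a, 'b) monoid_scheme \<Rightarrow> nat \<Rightarrow> (nat \<Rightarrow> 'a) monoid" where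
  "direct_power A k = product_group {..<k} (\<lambda>_. A)"

lemma group_int_wreath:
  assumes "group N"
  shows "group (int_wreath N)"
proof -
  define S where "S = sum_group (UNIV :: int set) (\<lambda>_. N)"
  interpret S: group S unfolding S_def using assms by simp
  have carrier: "carrier S = {f. (\<forall>i. f i \<in> carrier N) \<and> finite {i. f i \<noteq> \<one>\<^bsub>N\<^esub>}}"
    unfolding S_def using carrier_sum_group[of "UNIV :: int set" "\<lambda>_. N"] assms
    by (auto simp: PiE_def)
  have mult: "f \<otimes>\<^bsub>S\<^esub> g = (\<lambda>i. f i \<otimes>\<^bsub>N\<^esub> g i)" for f g
    by (simp add: S_def restrict_def)
  have one: "\<one>\<^bsub>S\<^esub> = (\<lambda>i. \<one>\<^bsub>N\<^esub>)"
    by (simp add: S_def restrict_def)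
  have closed: "shift n f \<in> carrier S" if "f \<in> carrier S" for n f
  proof -
    have "{i. f (i - n) \<noteq> \<one>\<^bsub>N\<^esub>} = (\<lambda>i. i + n) ` {i. f i \<noteq> \<one>\<^bsub>N\<^esub>}"
      by (auto intro!: image_eqI[of _ "\<lambda>i. i + n" "_ - n"])
    then show ?thesis using that by (simp add: carrier shift_def)
  qed
  have add: "shift m (shift n f) = shift (m + n) f" for m n :: int and f :: "int \<Rightarrow> 'a"
    by (simp add: shift_def algebra_simps)
  have zero: "shift 0 f = f" for f :: "int \<Rightarrow> 'a"
    by (simp add: shift_def)
  have hom: "shift n (f \<otimes>\<^bsub>S\<^esub> g) = shift n f \<otimes>\<^bsub>S\<^esub> shift n g" for n f g
    by (simp add: mult shift_def)
  have shift_one: "shift n \<one>\<^bsub>S\<^esub> = \<one>\<^bsub>S\<^esub>" for n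
    by (simp add: one shift_def)
  have *: "int_wreath N =
      \<lparr>carrier = carrier S \<times> UNIV,
       monoid.mult = (\<lambda>(f, m) (g, n). (f \<otimes>\<^bsub>S\<^esub> shift m g, m + n)),
       one = (\<one>\<^bsub>S\<^esub>, 0)\<rparr>"
    unfolding int_wreath_def semidirect_product_def S_def[symmetric] by simp
  show ?thesis
    unfolding *
  proof (rule groupI)
    fix x
    assume "x \<in> carrier \<lparr>carrier = carrier S \<times> (UNIV :: int set),
       monoid.mult = (\<lambda>(f, m) (g, n). (f \<otimes>\<^bsub>S\<^esub> shift m g, m + n)), one = (\<one>\<^bsub>S\<^esub>, 0)\<rparr>"
    then obtain f n where x: "x = (f, n)" "f \<in> carrier S" by auto
    show "\<exists>y \<in> carrier \<lparr>carrier = carrier S \<times> (UNIV :: int set),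
       monoid.mult = (\<lambda>(f, m) (g, n). (f \<otimes>\<^bsub>S\<^esub> shift m g, m + n)), one = (\<one>\<^bsub>S\<^esub>, 0)\<rparr>.
        y \<otimes>\<^bsub>\<lparr>carrier = carrier S \<times> (UNIV :: int set),
       monoid.mult = (\<lambda>(f, m) (g, n). (f \<otimes>\<^bsub>S\<^esub> shift m g, m + n)), one = (\<one>\<^bsub>S\<^esub>, 0)\<rparr>\<^esub> x =
       \<one>\<^bsub>\<lparr>carrier = carrier S \<times> (UNIV :: int set),
       monoid.mult = (\<lambda>(f, m) (g, n). (f \<otimes>\<^bsub>S\<^esub> shift m g, m + n)), one = (\<one>\<^bsub>S\<^esub>, 0)\<rparr>\<^esub>"
      using x closed
      by (intro bexI[of _ "(shift (- n) (inv\<^bsub>S\<^esub> f), - n)"]) (auto simp: hom[symmetric] shift_one)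
  qed (auto simp: closed hom add zero S.m_assoc)
qed

end

theory Submission
  imports Defs
begin

text \<open>Write \<open>A\<close> additively and a word as a (truncated) power series \<open>w \<in> A[[X]]\<close>. A state \<open>q\<close> is a
  polynomial of degree less than \<open>k\<close> and acts by \<open>w \<mapsto> (1 - X ^ k) w - q\<close>. So the automaton group
  is generated by the multiplication \<open>t\<close> by \<open>1 - X ^ k\<close> and the translations by polynomials of
  degree less than \<open>k\<close>, a copy of \<open>A ^ k\<close>. Conjugating by \<open>t ^ n\<close> turns the translation by \<open>q\<close> into
  the translation by \<open>(1 - X ^ k) ^ n q\<close>, so the conjugates of \<open>A ^ k\<close> commute. They are
  independent, because for \<open>n \<ge> 0\<close> the coefficients of \<open>(1 - X ^ k) ^ n q\<close> at \<open>X ^ (n k + j)\<close>, \<open>j < k\<close>,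
  are those of \<open>q\<close> up to sign, while all later coefficients vanish.\<close>

section \<open>Recognising a wreath product\<close>

text \<open>The abstract situation behind the theorem: \<open>\<tau>\<close> embeds the abelian
  group \<open>S\<close> in \<open>B\<close>, and by \<open>intertwine\<close> conjugation by
  \<open>t\<close> acts on that image as the automorphism \<open>T\<close>. In the application
  \<open>S\<close> consists of power series, \<open>T\<close> multiplies by
  \<open>1 - X ^ k\<close>, and \<open>\<iota>\<close> sends \<open>A ^ k\<close> to the polynomials
  of degree less than \<open>k\<close>.\<close>

locale wreath_representation =
  B: group B + S: comm_group S + N: group N
  for B :: "('b, 'x) monoid_scheme" (structure)
    and S :: "('s, 'y) monoid_scheme" and N :: "('n, 'z) monoid_scheme" +
  fixes t :: 'b and \<tau> :: "'s \<Rightarrow> 'b" and T :: "'s \<Rightarrow> 's" and \<iota> :: "'n \<Rightarrow> 's"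
  assumes t_closed: "t \<in> carrier B"
    and tau: "\<tau> \<in> mon S B"
    and T_auto: "T \<in> auto S"
    and iota: "\<iota> \<in> hom N S"
    and intertwine: "x \<in> carrier S \<Longrightarrow> t \<otimes> \<tau> x = \<tau> (T x) \<otimes> t"
begin

text \<open>Taking powers in the automorphism group makes negative exponents available.\<close>

definition T_pow :: "int \<Rightarrow> 's \<Rightarrow> 's" where
  "T_pow n = T [^]\<^bsub>AutoGroup S\<^esub> n"

text \<open>Pulled back to \<open>S\<close> along \<open>\<tau>\<close>, the factor at
  \<open>i\<close> is the conjugate of the image of \<open>f i\<close> by \<open>t ^ i\<close>. For
  \<open>f\<close> in the base group this is a finite product.\<close>

definition conj_prod :: "(int \<Rightarrow> 'n) \<Rightarrow> 's" where
  "conj_prod f = finprod S (\<lambda>i. T_pow i (\<iota> (f i))) {i. f i \<noteq> \<one>\<^bsub>N\<^esub>}"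

text \<open>The candidate isomorphism: the base group goes to products of conjugates, and the
  generator of the integers goes to \<open>t\<close>.\<close>

definition rep :: "(int \<Rightarrow> 'n) \<times> int \<Rightarrow> 'b" where
  "rep = (\<lambda>(f, n). \<tau> (conj_prod f) \<otimes> t [^] n)"

abbreviation "base \<equiv> sum_group (UNIV :: int set) (\<lambda>_. N)"

lemma carrier_base: "carrier base = {f. (\<forall>i. f i \<in> carrier N) \<and> finite {i. f i \<noteq> \<one>\<^bsub>N\<^esub>}}"
  using carrier_sum_group[of "UNIV :: int set" "\<lambda>_. N"] N.is_group by (auto simp: PiE_def)

lemma tau_inj: "inj_on \<tau> (carrier S)"
  using tau by (simp add: mon_def)

lemma tau_hom: "\<tau> \<in> hom S B"
  using tau by (simp add: mon_def)

sublocale tau: group_hom S B \<tau>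
  by unfold_locales (fact tau_hom)

sublocale iota: group_hom N S \<iota>
  by unfold_locales (fact iota)

section \<open>Powers of \<open>T\<close> and conjugation by powers of \<open>t\<close>\<close>

lemma T_pow_auto: "T_pow n \<in> auto S"
proof -
  interpret C: group "AutoGroup S" by (rule S.AutoGroup)
  have "T \<in> carrier (AutoGroup S)" using T_auto by (simp add: AutoGroup_def)
  from C.int_pow_closed[OF this] show ?thesis by (simp add: T_pow_def AutoGroup_def)
qed

lemma T_pow_hom: "T_pow n \<in> hom S S"
  using T_pow_auto by (simp add: auto_def)

lemma T_pow_closed [simp]: "x \<in> carrier S \<Longrightarrow> T_pow n x \<in> carrier S"
  using T_pow_hom by (rule hom_in_carrier)

lemma T_pow_mult:
  "x \<in> carrier S \<Longrightarrow> y \<in> carrier S \<Longrightarrow> T_pow n (x \<otimes>\<^bsub>S\<^esub> y) = T_pow n x \<otimes>\<^bsub>S\<^esub> T_pow n y"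
  using T_pow_hom by (rule hom_mult)

lemma T_pow_one [simp]: "T_pow n \<one>\<^bsub>S\<^esub> = \<one>\<^bsub>S\<^esub>"
  using T_pow_hom S.is_group S.is_group by (rule hom_one)

lemma mult_AutoGroup:
  "g \<in> auto S \<Longrightarrow> h \<in> auto S \<Longrightarrow> x \<in> carrier S \<Longrightarrow> (g \<otimes>\<^bsub>AutoGroup S\<^esub> h) x = g (h x)"
  by (simp add: AutoGroup_def BijGroup_def auto_def compose_eq)

lemma T_pow_add:
  assumes "x \<in> carrier S"
  shows "T_pow (m + n) x = T_pow m (T_pow n x)"
proof -
  interpret C: group "AutoGroup S" by (rule S.AutoGroup)
  have "T \<in> carrier (AutoGroup S)" using T_auto by (simp add: AutoGroup_def)
  then have "T_pow (m + n) = T_pow m \<otimes>\<^bsub>AutoGroup S\<^esub> T_pow n"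
    by (simp add: T_pow_def C.int_pow_mult)
  then show ?thesis
    using mult_AutoGroup[OF T_pow_auto T_pow_auto assms] by simp
qed

lemma T_pow_0 [simp]: "x \<in> carrier S \<Longrightarrow> T_pow 0 x = x"
  by (simp add: T_pow_def AutoGroup_def BijGroup_def)

lemma T_pow_1: "T_pow 1 = T"
proof -
  interpret C: group "AutoGroup S" by (rule S.AutoGroup)
  have "T \<in> carrier (AutoGroup S)" using T_auto by (simp add: AutoGroup_def)
  then show ?thesis by (simp add: T_pow_def C.int_pow_1)
qed

lemma T_pow_Suc: "x \<in> carrier S \<Longrightarrow> T_pow (int (Suc n)) x = T (T_pow (int n) x)"
  using T_pow_add[of x 1 "int n"] by (simp add: T_pow_1 add.commute)

lemma intertwine_nat:
  assumes "x \<in> carrier S"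
  shows "t [^] int n \<otimes> \<tau> x = \<tau> (T_pow (int n) x) \<otimes> t [^] int n"
proof (induction n)
  case 0
  then show ?case using assms by simp
next
  case (Suc n)
  have tn: "t [^] int (Suc n) = t \<otimes> t [^] int n"
    using B.int_pow_mult[of t 1 "int n"] t_closed by (simp add: B.int_pow_1)
  have "t [^] int (Suc n) \<otimes> \<tau> x = t \<otimes> (\<tau> (T_pow (int n) x) \<otimes> t [^] int n)"
    using assms t_closed Suc by (simp add: tn B.m_assoc del: of_nat_Suc)
  also have "\<dots> = (t \<otimes> \<tau> (T_pow (int n) x)) \<otimes> t [^] int n"
    using assms t_closed by (simp add: B.m_assoc)
  also have "\<dots> = \<tau> (T_pow (int (Suc n)) x) \<otimes> t [^] int (Suc n)"
    using assms t_closed intertwine[of "T_pow (int n) x"] T_pow_closed[of x "int (Suc n)"]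
    by (simp add: tn T_pow_Suc B.m_assoc del: of_nat_Suc)
  finally show ?case .
qed

text \<open>For a negative exponent \<open>n = - m\<close>, the nonnegative case is applied to
  \<open>T_pow n x\<close>, which \<open>T_pow m\<close> takes back to \<open>x\<close>. Multiplying
  that equation by the inverse of \<open>t ^ m\<close> on both sides gives the claim.\<close>

lemma intertwine_pow:
  assumes "x \<in> carrier S"
  shows "t [^] n \<otimes> \<tau> x = \<tau> (T_pow n x) \<otimes> t [^] n"
proof (cases "n \<ge> 0")
  case True
  then show ?thesis using intertwine_nat[OF assms, of "nat n"] by simp
next
  case False
  define m where "m = int (nat (- n))"
  have n: "n = - m" using False by (simp add: m_def)
  have x: "T_pow m (T_pow n x) = x"
    using T_pow_add[OF assms, of m n] assms by (simp add: n)
  have eq: "t [^] m \<otimes> \<tau> (T_pow n x) = \<tau> x \<otimes> t [^] m"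
    using intertwine_nat[of "T_pow n x" "nat (- n)"] assms x by (simp add: m_def)
  have "t [^] n \<otimes> \<tau> x = inv (t [^] m) \<otimes> (\<tau> x \<otimes> t [^] m) \<otimes> inv (t [^] m)"
    using assms t_closed by (simp add: n B.int_pow_neg B.m_assoc)
  also have "\<dots> = inv (t [^] m) \<otimes> (t [^] m \<otimes> \<tau> (T_pow n x)) \<otimes> inv (t [^] m)"
    by (simp only: eq)
  also have "\<dots> = \<tau> (T_pow n x) \<otimes> t [^] n"
    using assms t_closed by (simp add: n B.int_pow_neg B.m_assoc[symmetric])
  finally show ?thesis .
qed

section \<open>Products of conjugates\<close>

lemma conj_prod_superset:
  assumes "finite F" "{i. f i \<noteq> \<one>\<^bsub>N\<^esub>} \<subseteq> F" "f \<in> carrier base"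
  shows "conj_prod f = finprod S (\<lambda>i. T_pow i (\<iota> (f i))) F"
  unfolding conj_prod_def
  by (rule S.finprod_mono_neutral_cong_left) (use assms in \<open>auto simp: carrier_base\<close>)

lemma conj_prod_closed [simp]: "f \<in> carrier base \<Longrightarrow> conj_prod f \<in> carrier S"
  unfolding conj_prod_def by (rule S.finprod_closed) (auto simp: carrier_base)

text \<open>Since \<open>S\<close> is abelian, a product of products can be rearranged factor by
  factor. All three products are first extended to the union of the supports, because cancellation
  can make the support of the product smaller.\<close>

lemma conj_prod_mult:
  assumes "f \<in> carrier base" "g \<in> carrier base"
  shows "conj_prod (f \<otimes>\<^bsub>base\<^esub> g) = conj_prod f \<otimes>\<^bsub>S\<^esub> conj_prod g"
proof -
  interpret base: group base by simp
  define F where "F = {i. f i \<noteq> \<one>\<^bsub>N\<^esub>} \<union> {i. g i \<noteq> \<one>\<^bsub>N\<^esub>}"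
  have fin: "finite F" using assms by (simp add: F_def carrier_base)
  have mem: "f i \<in> carrier N" "g i \<in> carrier N" for i using assms by (auto simp: carrier_base)
  have "conj_prod (f \<otimes>\<^bsub>base\<^esub> g) = finprod S (\<lambda>i. T_pow i (\<iota> ((f \<otimes>\<^bsub>base\<^esub> g) i))) F"
    by (rule conj_prod_superset[OF fin _ base.m_closed[OF assms]]) (auto simp: F_def)
  also have "\<dots> = finprod S (\<lambda>i. T_pow i (\<iota> (f i)) \<otimes>\<^bsub>S\<^esub> T_pow i (\<iota> (g i))) F"
    using mem by (simp add: T_pow_mult)
  also have "\<dots> = finprod S (\<lambda>i. T_pow i (\<iota> (f i))) F \<otimes>\<^bsub>S\<^esub> finprod S (\<lambda>i. T_pow i (\<iota> (g i))) F"
    by (rule S.finprod_multf) (use mem in auto)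
  finally show ?thesis
    using conj_prod_superset[OF fin _ assms(1)] conj_prod_superset[OF fin _ assms(2)]
    by (simp add: F_def)
qed

lemma T_pow_finprod:
  assumes "finite F" "\<And>i. i \<in> F \<Longrightarrow> g i \<in> carrier S"
  shows "T_pow n (finprod S g F) = finprod S (\<lambda>i. T_pow n (g i)) F"
  using assms by (induction F) (auto simp: T_pow_mult Pi_iff)

text \<open>Reindexing by \<open>n + i\<close> turns each exponent \<open>i\<close> into
  \<open>n + i\<close>, and additivity of \<open>T_pow\<close> lets \<open>T_pow n\<close> be pulled
  out. Thus \<open>shift\<close> in the wreath product corresponds to conjugation by powers of
  \<open>t\<close>.\<close>

lemma conj_prod_shift:
  assumes "f \<in> carrier base"
  shows "conj_prod (shift n f) = T_pow n (conj_prod f)"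
proof -
  have mem: "f i \<in> carrier N" for i using assms by (auto simp: carrier_base)
  have supp: "{i. shift n f i \<noteq> \<one>\<^bsub>N\<^esub>} = (\<lambda>i. n + i) ` {i. f i \<noteq> \<one>\<^bsub>N\<^esub>}"
    by (auto simp: shift_def intro!: image_eqI[of _ "\<lambda>i. n + i" "_ - n"])
  have "conj_prod (shift n f) =
      finprod S (\<lambda>i. T_pow (n + i) (\<iota> (shift n f (n + i)))) {i. f i \<noteq> \<one>\<^bsub>N\<^esub>}"
    unfolding conj_prod_def supp
    by (rule S.finprod_reindex) (use mem in \<open>auto simp: shift_def\<close>)
  also have "\<dots> = finprod S (\<lambda>i. T_pow n (T_pow i (\<iota> (f i)))) {i. f i \<noteq> \<one>\<^bsub>N\<^esub>}"
    using mem by (simp add: shift_def T_pow_add)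
  also have "\<dots> = T_pow n (conj_prod f)"
    unfolding conj_prod_def
    by (rule T_pow_finprod[symmetric]) (use assms in \<open>auto simp: carrier_base\<close>)
  finally show ?thesis .
qed

section \<open>The representation of the wreath product\<close>

lemma int_wreath_simps:
  "carrier (int_wreath N) = carrier base \<times> UNIV"
  "(f, m) \<otimes>\<^bsub>int_wreath N\<^esub> (g, n) = (f \<otimes>\<^bsub>base\<^esub> shift m g, m + n)"
  "\<one>\<^bsub>int_wreath N\<^esub> = (\<one>\<^bsub>base\<^esub>, 0)"
  by (simp_all add: int_wreath_def semidirect_product_def)

lemma shift_closed:
  assumes "f \<in> carrier base"
  shows "shift n f \<in> carrier base"
proof -
  have "{i. f (i - n) \<noteq> \<one>\<^bsub>N\<^esub>} = (\<lambda>i. i + n) ` {i. f i \<noteq> \<one>\<^bsub>N\<^esub>}"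
    by (auto intro!: image_eqI[of _ "\<lambda>i. i + n" "_ - n"])
  then show ?thesis using assms by (simp add: carrier_base shift_def)
qed

text \<open>Moving \<open>t ^ m\<close> to the right past the base part of the second factor applies
  \<open>T_pow m\<close> to it, which is what the twist \<open>shift m\<close> of the semidirect
  product does.\<close>

lemma rep_hom: "rep \<in> hom (int_wreath N) B"
proof (rule homI)
  fix x assume "x \<in> carrier (int_wreath N)"
  then show "rep x \<in> carrier B"
    using t_closed by (auto simp: int_wreath_simps rep_def)
next
  fix x y assume "x \<in> carrier (int_wreath N)" "y \<in> carrier (int_wreath N)"
  then obtain f m g n where xy: "x = (f, m)" "y = (g, n)"
    and fg: "f \<in> carrier base" "g \<in> carrier base"
    by (auto simp: int_wreath_simps)
  have "rep (x \<otimes>\<^bsub>int_wreath N\<^esub> y) =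
      \<tau> (conj_prod f \<otimes>\<^bsub>S\<^esub> T_pow m (conj_prod g)) \<otimes> t [^] (m + n)"
    using fg shift_closed
    by (simp add: xy int_wreath_simps rep_def conj_prod_mult conj_prod_shift del: mult_sum_group)
  also have "\<dots> = \<tau> (conj_prod f) \<otimes> (\<tau> (T_pow m (conj_prod g)) \<otimes> t [^] m) \<otimes> t [^] n"
    using fg t_closed by (simp add: B.m_assoc B.int_pow_mult)
  also have "\<dots> = \<tau> (conj_prod f) \<otimes> (t [^] m \<otimes> \<tau> (conj_prod g)) \<otimes> t [^] n"
    using fg by (simp add: intertwine_pow)
  also have "\<dots> = rep x \<otimes> rep y"
    using fg t_closed by (simp add: xy rep_def B.m_assoc)
  finally show "rep (x \<otimes>\<^bsub>int_wreath N\<^esub> y) = rep x \<otimes> rep y" .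
qed

lemma conj_prod_single:
  assumes "x \<in> carrier N"
  shows "conj_prod (\<lambda>i. if i = n then x else \<one>\<^bsub>N\<^esub>) = T_pow n (\<iota> x)"
proof -
  have "conj_prod (\<lambda>i. if i = n then x else \<one>\<^bsub>N\<^esub>) =
      finprod S (\<lambda>i. T_pow i (\<iota> (if i = n then x else \<one>\<^bsub>N\<^esub>))) {n}"
    by (rule conj_prod_superset) (use assms in \<open>auto simp: carrier_base\<close>)
  then show ?thesis using assms by simp
qed

text \<open>Each generator is the image of an element supported at position \<open>0\<close> with
  integer part \<open>1\<close>. Conversely, the identity of \<open>N\<close> yields
  \<open>t\<close> as a generator; dividing by \<open>t\<close> yields every
  \<open>\<tau> (\<iota> x)\<close>, and conjugating by powers of \<open>t\<close> yields every
  factor of \<open>conj_prod\<close>.\<close>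

lemma rep_image:
  "rep ` carrier (int_wreath N) = generate B ((\<lambda>x. \<tau> (\<iota> x) \<otimes> t) ` carrier N)"
    (is "_ = generate B ?X")
proof
  interpret W: group "int_wreath N" by (rule group_int_wreath) simp
  interpret rep: group_hom "int_wreath N" B rep
    by unfold_locales (fact rep_hom)
  have X: "?X \<subseteq> carrier B" using t_closed by auto
  let ?K = "generate B ?X"
  interpret K: subgroup ?K B by (rule B.generate_is_subgroup[OF X])
  show "?K \<subseteq> rep ` carrier (int_wreath N)"
  proof (rule B.generate_subgroup_incl[OF _ rep.img_is_subgroup], safe)
    fix x assume x: "x \<in> carrier N"
    let ?s = "\<lambda>i. if i = 0 then x else \<one>\<^bsub>N\<^esub>"
    have "rep (?s, 1) = \<tau> (\<iota> x) \<otimes> t"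
      using x t_closed by (simp add: rep_def conj_prod_single)
    moreover have "(?s, 1) \<in> carrier (int_wreath N)"
      using x by (auto simp: int_wreath_simps carrier_base)
    ultimately show "\<tau> (\<iota> x) \<otimes> t \<in> rep ` carrier (int_wreath N)"
      by (metis image_eqI)
  qed
  have gen: "\<tau> (\<iota> x) \<otimes> t \<in> ?K" if "x \<in> carrier N" for x
    using that by (auto intro: generate.incl)
  have t: "t \<in> ?K" using gen[of "\<one>\<^bsub>N\<^esub>"] t_closed by simp
  have tpow: "t [^] (n :: int) \<in> ?K" for n
    using B.subgroup_int_pow_closed[OF K.subgroup_axioms t] .
  have "\<tau> (\<iota> x) = \<tau> (\<iota> x) \<otimes> t \<otimes> inv t" if "x \<in> carrier N" for x
    using that t_closed by (simp add: B.m_assoc)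
  then have ti: "\<tau> (\<iota> x) \<in> ?K" if "x \<in> carrier N" for x
    using that gen[OF that] t by (metis K.m_closed K.m_inv_closed)
  have conj: "\<tau> (T_pow n (\<iota> x)) \<in> ?K" if "x \<in> carrier N" for x n
  proof -
    have "\<tau> (T_pow n (\<iota> x)) = t [^] n \<otimes> \<tau> (\<iota> x) \<otimes> inv (t [^] n)"
      using that t_closed by (simp add: intertwine_pow B.m_assoc)
    then show ?thesis using that ti tpow by simp
  qed
  show "rep ` carrier (int_wreath N) \<subseteq> ?K"
  proof safe
    fix f :: "int \<Rightarrow> 'n" and n :: int assume "(f, n) \<in> carrier (int_wreath N)"
    then have f: "f \<in> carrier base" by (simp add: int_wreath_simps)
    have "\<tau> (finprod S (\<lambda>i. T_pow i (\<iota> (f i))) F) \<in> ?K" if "finite F" for F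
      using that
    proof (induction F)
      case (insert i F)
      have "f j \<in> carrier N" for j using f by (auto simp: carrier_base)
      then show ?case using insert conj by (simp add: Pi_iff)
    qed simp
    then have "\<tau> (conj_prod f) \<in> ?K" using f by (simp add: conj_prod_def carrier_base)
    then show "rep (f, n) \<in> ?K" using tpow by (simp add: rep_def)
  qed
qed

text \<open>It remains to see that \<open>rep\<close> is injective. If \<open>(f, n)\<close> is in
  the kernel, then \<open>t ^ n\<close> lies in the image of \<open>\<tau>\<close>, so
  \<open>T ^ n\<close> is trivial; this forces \<open>n = 0\<close>, and \<open>indep\<close> then
  disposes of \<open>f\<close>.\<close>

theorem generate_iso_int_wreath:
  assumes indep: "\<And>f. f \<in> carrier base \<Longrightarrow> conj_prod f = \<one>\<^bsub>S\<^esub> \<Longrightarrow> f = \<one>\<^bsub>base\<^esub>"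
    and nontriv: "carrier N \<noteq> {\<one>\<^bsub>N\<^esub>}"
  shows "B\<lparr>carrier := generate B ((\<lambda>x. \<tau> (\<iota> x) \<otimes> t) ` carrier N)\<rparr> \<cong> int_wreath N"
proof -
  interpret W: group "int_wreath N" by (rule group_int_wreath) simp
  interpret base: group base by simp
  interpret rep: group_hom "int_wreath N" B rep
    by unfold_locales (fact rep_hom)
  \<comment> \<open>If \<open>T ^ n = 1\<close>, then \<open>x\<close> in position \<open>n\<close> cancels against its inverse in position \<open>0\<close>.\<close>
  have faithful: "n = 0" if n: "\<And>x. x \<in> carrier S \<Longrightarrow> T_pow n x = x" for n
  proof (rule ccontr)
    assume "n \<noteq> 0"
    obtain x where x: "x \<in> carrier N" "x \<noteq> \<one>\<^bsub>N\<^esub>"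
      using nontriv N.one_closed by blast
    let ?s = "\<lambda>n x i :: int. if i = n then x else \<one>\<^bsub>N\<^esub>"
    have s: "?s m y \<in> carrier base" if "y \<in> carrier N" for m y
      using that by (auto simp: carrier_base)
    let ?f = "?s n x \<otimes>\<^bsub>base\<^esub> ?s 0 (inv\<^bsub>N\<^esub> x)"
    have "conj_prod ?f = T_pow n (\<iota> x) \<otimes>\<^bsub>S\<^esub> T_pow 0 (\<iota> (inv\<^bsub>N\<^esub> x))"
      using x s by (simp only: conj_prod_mult conj_prod_single N.inv_closed)
    also have "\<dots> = \<one>\<^bsub>S\<^esub>" using x n by simp
    finally have "?f = \<one>\<^bsub>base\<^esub>"
      using x s by (intro indep base.m_closed) simp_all
    then have "?f n = \<one>\<^bsub>N\<^esub>" by (metis UNIV_I one_sum_group restrict_apply)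
    then show False using x \<open>n \<noteq> 0\<close> by simp
  qed
  have "rep \<in> mon (int_wreath N) B"
    unfolding mon_iff_hom_one[OF W.is_group B.is_group]
  proof (intro conjI rep_hom allI impI, elim conjE)
    fix y assume "y \<in> carrier (int_wreath N)" and one: "rep y = \<one>"
    then obtain f n where y: "y = (f, n)" and f: "f \<in> carrier base"
      by (auto simp: int_wreath_simps)
    define p where "p = conj_prod f"
    have p: "p \<in> carrier S" using f by (simp add: p_def)
    have "\<tau> p \<otimes> t [^] n = \<one>" using one by (simp add: y rep_def p_def)
    then have tn: "t [^] n = \<tau> (inv\<^bsub>S\<^esub> p)"
      using p t_closed by (metis B.int_pow_closed B.inv_equality B.inv_inv tau.hom_closed tau.hom_inv)
    \<comment> \<open>\<open>t ^ n\<close> commutes with \<open>\<tau> x\<close>, since both lie in the image of the abelian group \<open>S\<close>.\<close>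
    have "T_pow n x = x" if x: "x \<in> carrier S" for x
    proof -
      have "\<tau> (inv\<^bsub>S\<^esub> p \<otimes>\<^bsub>S\<^esub> x) = \<tau> (T_pow n x \<otimes>\<^bsub>S\<^esub> inv\<^bsub>S\<^esub> p)"
        using intertwine_pow[OF x, of n] x p by (simp add: tn)
      then have "inv\<^bsub>S\<^esub> p \<otimes>\<^bsub>S\<^esub> x = T_pow n x \<otimes>\<^bsub>S\<^esub> inv\<^bsub>S\<^esub> p"
        by (rule inj_onD[OF tau_inj]) (use x p in simp_all)
      then show ?thesis using x p by (simp add: S.m_comm[of "inv\<^bsub>S\<^esub> p" x])
    qed
    then have n: "n = 0" by (rule faithful)
    then have "\<tau> (inv\<^bsub>S\<^esub> p) = \<tau> \<one>\<^bsub>S\<^esub>" using tn by simp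
    then have "inv\<^bsub>S\<^esub> p = \<one>\<^bsub>S\<^esub>"
      by (rule inj_onD[OF tau_inj]) (use p in simp_all)
    then have "p = \<one>\<^bsub>S\<^esub>" using p by simp
    then show "y = \<one>\<^bsub>int_wreath N\<^esub>"
      using indep[OF f] n by (simp add: y p_def int_wreath_simps)
  qed
  \<comment> \<open>An injective homomorphism is an isomorphism onto its image, and
    \<open>rep_image\<close> identifies that image with the generated subgroup.\<close>
  then have "rep \<in> iso (int_wreath N) (B\<lparr>carrier := rep ` carrier (int_wreath N)\<rparr>)"
    by (auto simp: mon_def iso_def hom_def bij_betw_def)
  then show ?thesis
    unfolding rep_image by (intro W.iso_sym is_isoI)
qed

end

section \<open>The automaton group acting by affine maps\<close>

text \<open>The state is a window sliding along \<open>q @ w\<close>, so the letter subtracted at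
  position \<open>i\<close> is the letter of \<open>q @ w\<close> at \<open>i\<close>. The zip
  inside \<open>map2\<close> cuts the longer list off at the length of \<open>w\<close>.\<close>

lemma run_de_bruijn_mealy:
  assumes "q \<noteq> []"
  shows "run (de_bruijn_mealy k A) w q = map2 (\<lambda>x y. x \<otimes>\<^bsub>A\<^esub> inv\<^bsub>A\<^esub> y) w (q @ w)"
  using assms
proof (induction w arbitrary: q)
  case (Cons a w)
  then show ?case by (cases q) simp_all
qed simp

context comm_group
begin

section \<open>The additive group of power series and multiplication by
  \<open>1 - X ^ k\<close>\<close>

abbreviation sequences :: "(nat \<Rightarrow> 'a) monoid" where
  "sequences \<equiv> product_group UNIV (\<lambda>_. G)"

lemma carrier_sequences: "carrier sequences = {x. \<forall>i. x i \<in> carrier G}"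
  by (auto simp: PiE_def)

lemma sequences_simps:
  "x \<otimes>\<^bsub>sequences\<^esub> y = (\<lambda>i. x i \<otimes> y i)" "\<one>\<^bsub>sequences\<^esub> = (\<lambda>i. \<one>)"
  by (simp_all add: restrict_def)

lemma comm_group_sequences: "comm_group sequences"
proof -
  interpret S: group sequences using is_group by simp
  show ?thesis
    by (rule S.group_comm_groupI) (auto simp: m_comm PiE_iff)
qed

text \<open>\<^term>\<open>difference k\<close> is the multiplication by \<open>1 - X ^ k\<close>.\<close>

definition difference :: "nat \<Rightarrow> (nat \<Rightarrow> 'a) \<Rightarrow> nat \<Rightarrow> 'a" where
  "difference k = (\<lambda>x\<in>carrier sequences. \<lambda>i. x i \<otimes> inv (if i < k then \<one> else x (i - k)))"

text \<open>Multiplication by the inverse series \<open>1 + X ^ k + X ^ (2 k) + ...\<close>,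
  computed by the recursion \<open>y i = x i + y (i - k)\<close>. The test \<open>k = 0\<close> is
  there for termination.\<close>

fun antidifference :: "nat \<Rightarrow> (nat \<Rightarrow> 'a) \<Rightarrow> nat \<Rightarrow> 'a" where
  "antidifference k x i = (if k = 0 \<or> i < k then x i else x i \<otimes> antidifference k x (i - k))"

declare antidifference.simps [simp del]

lemma antidifference_closed:
  assumes "x \<in> carrier sequences"
  shows "antidifference k x i \<in> carrier G"
  using assms
  by (induction k x i rule: antidifference.induct)
    (subst antidifference.simps, auto simp: carrier_sequences simp del: carrier_product_group)

lemma antidifference_difference:
  assumes "x \<in> carrier sequences" "k > 0"
  shows "antidifference k (difference k x) i = x i"
proof (induction i rule: less_induct)
  case (less i)
  have x: "x j \<in> carrier G" for j
    using assms by (simp add: carrier_sequences del: carrier_product_group)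
  show ?case
    using less[of "i - k"] assms x
    by (subst antidifference.simps) (auto simp: difference_def m_assoc simp del: carrier_product_group)
qed

lemma difference_antidifference:
  assumes "x \<in> carrier sequences" "k > 0"
  shows "difference k (antidifference k x) i = x i"
proof -
  have "antidifference k x \<in> carrier sequences"
    using antidifference_closed[OF assms(1)]
    by (simp add: carrier_sequences del: carrier_product_group)
  moreover have "x i \<in> carrier G"
    using assms by (simp add: carrier_sequences del: carrier_product_group)
  ultimately show ?thesis
    using assms antidifference_closed[OF assms(1)]
    by (auto simp: difference_def m_assoc antidifference.simps[of k x i]
        simp del: carrier_product_group)
qed

lemma difference_hom: "difference k \<in> hom sequences sequences"
proof (rule homI)
  fix x assume "x \<in> carrier sequences"
  then show "difference k x \<in> carrier sequences"
    by (auto simp: difference_def carrier_sequences simp del: carrier_product_group)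
next
  fix x y assume "x \<in> carrier sequences" "y \<in> carrier sequences"
  then have mem: "x i \<in> carrier G" "y i \<in> carrier G" for i
    by (simp_all add: carrier_sequences del: carrier_product_group)
  then show "difference k (x \<otimes>\<^bsub>sequences\<^esub> y) = difference k x \<otimes>\<^bsub>sequences\<^esub> difference k y"
    by (auto simp: difference_def carrier_sequences sequences_simps inv_mult m_ac fun_eq_iff
        simp del: carrier_product_group mult_product_group)
qed

lemma difference_auto:
  assumes "k > 0"
  shows "difference k \<in> auto sequences"
proof -
  have "bij_betw (difference k) (carrier sequences) (carrier sequences)"
  proof (rule bij_betw_byWitness[where f' = "antidifference k"])
    show "difference k ` carrier sequences \<subseteq> carrier sequences"
      using hom_in_carrier[OF difference_hom] by blast
    show "antidifference k ` carrier sequences \<subseteq> carrier sequences"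
      using antidifference_closed by (auto simp: carrier_sequences simp del: carrier_product_group)
  qed (use assms antidifference_difference difference_antidifference in blast)+
  then show ?thesis
    using difference_hom by (auto simp: auto_def Bij_def difference_def)
qed

section \<open>Translations of words by power series\<close>

definition translation :: "(nat \<Rightarrow> 'a) \<Rightarrow> 'a list \<Rightarrow> 'a list" where
  "translation x = (\<lambda>w\<in>lists (carrier G). map2 (\<otimes>) w (map x [0..<length w]))"

lemma length_translation [simp]:
  "w \<in> lists (carrier G) \<Longrightarrow> length (translation x w) = length w"
  by (simp add: translation_def)

lemma nth_translation [simp]:
  "w \<in> lists (carrier G) \<Longrightarrow> i < length w \<Longrightarrow> translation x w ! i = w ! i \<otimes> x i"
  by (simp add: translation_def)

lemma lists_nth: "w \<in> lists (carrier G) \<longleftrightarrow> (\<forall>i < length w. w ! i \<in> carrier G)"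
  by (metis in_lists_conv_set in_set_conv_nth)

lemma translation_closed:
  assumes "x \<in> carrier sequences" "w \<in> lists (carrier G)"
  shows "translation x w \<in> lists (carrier G)"
  unfolding lists_nth
  using assms by (auto simp: lists_nth[of w] carrier_sequences simp del: carrier_product_group)

lemma translation_translation:
  assumes "x \<in> carrier sequences" "y \<in> carrier sequences" "w \<in> lists (carrier G)"
  shows "translation x (translation y w) = translation (x \<otimes>\<^bsub>sequences\<^esub> y) w"
proof (rule nth_equalityI)
  fix i assume "i < length (translation x (translation y w))"
  moreover have "w ! i \<in> carrier G" if "i < length w"
    using that assms(3) by (simp add: lists_nth)
  ultimately show "translation x (translation y w) ! i = translation (x \<otimes>\<^bsub>sequences\<^esub> y) w ! i"
    using assms translation_closed
    by (auto simp: sequences_simps carrier_sequences m_ac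
        simp del: carrier_product_group mult_product_group)
qed (use assms translation_closed in simp_all)

lemma translation_one:
  assumes "w \<in> lists (carrier G)"
  shows "translation \<one>\<^bsub>sequences\<^esub> w = w"
proof (rule nth_equalityI)
  show "translation \<one>\<^bsub>sequences\<^esub> w ! i = w ! i" if "i < length (translation \<one>\<^bsub>sequences\<^esub> w)" for i
    using that assms lists_nth[of w] by (simp add: sequences_simps del: one_product_group)
qed (use assms in simp)

lemma translation_Bij:
  assumes x: "x \<in> carrier sequences"
  shows "translation x \<in> Bij (lists (carrier G))"
proof -
  interpret S: comm_group sequences by (rule comm_group_sequences)
  have inv: "inv\<^bsub>sequences\<^esub> x \<in> carrier sequences" using x by (rule S.inv_closed)
  have "bij_betw (translation x) (lists (carrier G)) (lists (carrier G))"
  proof (rule bij_betw_byWitness[where f' = "translation (inv\<^bsub>sequences\<^esub> x)"];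
      intro ballI image_subsetI)
    fix w assume w: "w \<in> lists (carrier G)"
    show "translation (inv\<^bsub>sequences\<^esub> x) (translation x w) = w"
      using translation_translation[OF inv x w] translation_one[OF w] S.l_inv[OF x] by simp
    show "translation x (translation (inv\<^bsub>sequences\<^esub> x) w) = w"
      using translation_translation[OF x inv w] translation_one[OF w] S.r_inv[OF x] by simp
    show "translation x w \<in> lists (carrier G)"
      by (rule translation_closed[OF x w])
    show "translation (inv\<^bsub>sequences\<^esub> x) w \<in> lists (carrier G)"
      by (rule translation_closed[OF inv w])
  qed
  then show ?thesis by (simp add: Bij_def translation_def)
qed

lemma mult_BijGroup:
  "f \<in> Bij S \<Longrightarrow> g \<in> Bij S \<Longrightarrow> f \<otimes>\<^bsub>BijGroup S\<^esub> g = (\<lambda>x\<in>S. f (g x))"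
  by (simp add: BijGroup_def compose_def)

lemma translation_mon: "translation \<in> mon sequences (BijGroup (lists (carrier G)))"
proof -
  have "translation \<in> hom sequences (BijGroup (lists (carrier G)))"
  proof (rule homI)
    fix x assume "x \<in> carrier sequences"
    then show "translation x \<in> carrier (BijGroup (lists (carrier G)))"
      using translation_Bij by (simp add: BijGroup_def)
  next
    fix x y assume xy: "x \<in> carrier sequences" "y \<in> carrier sequences"
    show "translation (x \<otimes>\<^bsub>sequences\<^esub> y) =
        translation x \<otimes>\<^bsub>BijGroup (lists (carrier G))\<^esub> translation y"
      unfolding mult_BijGroup[OF xy[THEN translation_Bij]]
    proof
      fix w
      show "translation (x \<otimes>\<^bsub>sequences\<^esub> y) w =
          (\<lambda>w\<in>lists (carrier G). translation x (translation y w)) w"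
        using translation_translation[OF xy, of w]
        by (cases "w \<in> lists (carrier G)") (simp, simp add: translation_def)
    qed
  qed
  moreover have "inj_on translation (carrier sequences)"
  proof (rule inj_onI, rule ext)
    fix x y i
    assume xy: "x \<in> carrier sequences" "y \<in> carrier sequences" and eq: "translation x = translation y"
    \<comment> \<open>On the zero word of length \<open>Suc i\<close>, a translation shows its own
      coefficient at \<open>i\<close>.\<close>
    let ?w = "replicate (Suc i) \<one>"
    have w: "?w \<in> lists (carrier G)" by (auto simp: in_lists_conv_set)
    have nth: "?w ! i = \<one>" by (simp del: replicate_Suc)
    have "translation x ?w ! i = translation y ?w ! i" using eq by simp
    then show "x i = y i"
      using xy w nth by (simp add: carrier_sequences del: replicate_Suc carrier_product_group)
  qed
  ultimately show ?thesis by (simp add: mon_def)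
qed

section \<open>States as polynomials of degree less than \<open>k\<close>\<close>

lemma state_map_nth:
  assumes "q \<in> lists (carrier G)" "q \<noteq> []" "w \<in> lists (carrier G)"
  shows "length (state_map (de_bruijn_mealy k G) q w) = length w"
    and "i < length w \<Longrightarrow>
      state_map (de_bruijn_mealy k G) q w ! i = w ! i \<otimes> inv ((q @ w) ! i)"
  using assms by (simp_all add: state_map_def run_de_bruijn_mealy)

text \<open>Members of \<open>direct_power\<close> are \<open>undefined\<close> from index
  \<open>k\<close> on; as a polynomial such a tuple must be continued by the neutral element
  instead.\<close>

definition block :: "nat \<Rightarrow> (nat \<Rightarrow> 'a) \<Rightarrow> nat \<Rightarrow> 'a" where
  "block k x i = (if i < k then x i else \<one>)"

lemma block_hom: "block k \<in> hom (direct_power G k) sequences"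
proof (rule homI)
  fix x assume "x \<in> carrier (direct_power G k)"
  then have "x i \<in> carrier G" if "i < k" for i
    using that by (auto simp: direct_power_def)
  then show "block k x \<in> carrier sequences"
    by (simp add: block_def carrier_sequences del: carrier_product_group)
next
  fix x y
  show "block k (x \<otimes>\<^bsub>direct_power G k\<^esub> y) = block k x \<otimes>\<^bsub>sequences\<^esub> block k y"
    by (rule ext) (simp add: block_def direct_power_def sequences_simps)
qed

end

section \<open>The automaton group as an instance of the abstract situation\<close>

locale de_bruijn_group = comm_group A for A :: "('a, 'b) monoid_scheme" +
  fixes k :: nat
  assumes k_pos: "k > 0"
begin

abbreviation "M \<equiv> de_bruijn_mealy k A"
abbreviation "W \<equiv> lists (carrier A)"
abbreviation "t \<equiv> state_map M (replicate k \<one>\<^bsub>A\<^esub>)"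

lemma state_map_Bij:
  assumes "q \<in> lists (carrier A)" "length q = k"
  shows "state_map M q \<in> Bij W"
  using state_map_in_BijGroup[OF invertible_de_bruijn_mealy[OF is_group k_pos], of q] assms
  by (simp add: BijGroup_def)

lemma replicate_one: "replicate n \<one>\<^bsub>A\<^esub> \<in> lists (carrier A)"
  by (auto simp: in_lists_conv_set)

lemma t_Bij: "t \<in> Bij W"
  by (rule state_map_Bij[OF replicate_one length_replicate])

text \<open>Prefixing \<open>w\<close> with \<open>k\<close> neutral letters delays it by
  \<open>k\<close> places, so the neutral state multiplies by \<open>1 - X ^ k\<close>.\<close>

lemma t_nth:
  assumes "w \<in> W"
  shows "length (t w) = length w"
    and "i < length w \<Longrightarrow> t w ! i = w ! i \<otimes>\<^bsub>A\<^esub> inv\<^bsub>A\<^esub> (if i < k then \<one>\<^bsub>A\<^esub> else w ! (i - k))"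
  using state_map_nth[where k = k, OF replicate_one[of k] _ assms] k_pos by (auto simp: nth_append)

lemma t_closed_words: "w \<in> W \<Longrightarrow> t w \<in> W"
  using Bij_imp_funcset[OF t_Bij] by auto

text \<open>The main point is the intertwining relation. As \<open>t\<close> is additive,
  \<open>t (w + x) = t w + (1 - X ^ k) x\<close>, which is checked letter by letter.\<close>

sublocale wreath_representation "BijGroup W" sequences "direct_power A k" t translation
  "difference k" "block k"
proof (intro wreath_representation.intro wreath_representation_axioms.intro)
  show "group (direct_power A k)" using is_group by (simp add: direct_power_def)
  show "t \<in> carrier (BijGroup W)"
    using t_Bij by (simp add: BijGroup_def)
  fix x assume x: "x \<in> carrier sequences"
  have Tx: "difference k x \<in> carrier sequences"
    using hom_in_carrier[OF difference_hom x] .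
  have "t (translation x w) = translation (difference k x) (t w)" if w: "w \<in> W" for w
  proof (rule nth_equalityI)
    note xw = translation_closed[OF x w]
    fix i assume i: "i < length (t (translation x w))"
    have "w ! j \<in> carrier A" if "j < length w" for j using that w by (simp add: lists_nth)
    moreover have "x j \<in> carrier A" for j
      using x by (simp add: carrier_sequences del: carrier_product_group)
    ultimately show "t (translation x w) ! i = translation (difference k x) (t w) ! i"
      using i x w t_nth[OF xw] t_nth[OF w] t_closed_words[OF w]
      by (auto simp: difference_def inv_mult m_ac simp del: carrier_product_group)
  qed (use x w t_nth t_closed_words translation_closed in simp)
  then show "t \<otimes>\<^bsub>BijGroup W\<^esub> translation x = translation (difference k x) \<otimes>\<^bsub>BijGroup W\<^esub> t"
    unfolding mult_BijGroup[OF t_Bij translation_Bij[OF x]]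
      mult_BijGroup[OF translation_Bij[OF Tx] t_Bij]
    by (rule restrict_ext)
qed (intro is_group group_BijGroup comm_group_sequences translation_mon
    difference_auto[OF k_pos] block_hom)+

text \<open>The state \<open>q\<close> acts as \<open>t\<close> followed by the translation by
  \<open>- q\<close>, because its letters are subtracted. Letterwise inversion therefore matches
  states with elements of \<open>A ^ k\<close>, in both directions.\<close>

lemma states_eq:
  "state_map M ` states M =
    (\<lambda>x. translation (block k x) \<otimes>\<^bsub>BijGroup W\<^esub> t) ` carrier (direct_power A k)"
proof -
  have eq: "state_map M q = translation (block k x) \<otimes>\<^bsub>BijGroup W\<^esub> t"
    if q: "q \<in> lists (carrier A)" "length q = k" and x: "x \<in> carrier (direct_power A k)"
      and xq: "\<And>i. i < k \<Longrightarrow> x i = inv\<^bsub>A\<^esub> (q ! i)" for q x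
  proof
    fix w
    have bx: "block k x \<in> carrier sequences"
      using x by (rule iota.hom_closed)
    show "state_map M q w = (translation (block k x) \<otimes>\<^bsub>BijGroup W\<^esub> t) w"
    proof (cases "w \<in> W")
      case True
      have "state_map M q w = translation (block k x) (t w)"
      proof (rule nth_equalityI)
        fix i assume i: "i < length (state_map M q w)"
        have "w ! j \<in> carrier A" if "j < length w" for j using that True by (simp add: lists_nth)
        moreover have "q ! j \<in> carrier A" if "j < k" for j using that q by (simp add: lists_nth)
        moreover have "i < length w" "q \<noteq> []"
          using i q k_pos True state_map_nth(1)[where q = q and w = w and k = k] by auto
        moreover from this have "translation (block k x) (t w) ! i = t w ! i \<otimes>\<^bsub>A\<^esub> block k x i"
          using t_nth(1)[OF True] by (intro nth_translation[OF t_closed_words[OF True]]) simp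
        \<comment> \<open>For \<open>i < k\<close> the letter subtracted is \<open>q ! i\<close>,
          which comes from the translation. For later \<open>i\<close> it is
          \<open>w ! (i - k)\<close>, which \<open>t\<close> has subtracted already.\<close>
        ultimately show "state_map M q w ! i = translation (block k x) (t w) ! i"
          using q True state_map_nth(2)[where q = q and w = w and k = k] t_nth(2)[OF True] xq
          by (simp add: nth_append block_def)
      qed (use q k_pos True state_map_nth[where q = q and w = w and k = k] t_nth t_closed_words in auto)
      then show ?thesis
        using True bx by (simp add: mult_BijGroup t_Bij translation_Bij
            del: carrier_product_group)
    next
      case False
      then have "state_map M q w = undefined" by (simp add: state_map_def)
      then show ?thesis
        using False bx by (simp add: mult_BijGroup t_Bij translation_Bij
            del: carrier_product_group)
    qed
  qed
  show ?thesis
  proof (intro equalityI subsetI; elim imageE)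
    fix g q assume g: "g = state_map M q" and "q \<in> states M"
    then have q: "q \<in> lists (carrier A)" "length q = k" by simp_all
    define x where "x = (\<lambda>i\<in>{..<k}. inv\<^bsub>A\<^esub> (q ! i))"
    have x: "x \<in> carrier (direct_power A k)"
      using q by (auto simp: direct_power_def x_def lists_nth)
    moreover have "g = translation (block k x) \<otimes>\<^bsub>BijGroup W\<^esub> t"
      unfolding g by (rule eq[OF q x]) (simp add: x_def)
    ultimately show "g \<in> (\<lambda>x. translation (block k x) \<otimes>\<^bsub>BijGroup W\<^esub> t) ` carrier (direct_power A k)"
      by blast
  next
    fix g x assume g: "g = translation (block k x) \<otimes>\<^bsub>BijGroup W\<^esub> t"
      and x: "x \<in> carrier (direct_power A k)"
    have mem: "x i \<in> carrier A" if "i < k" for i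
      using x that by (auto simp: direct_power_def)
    define q where "q = map (\<lambda>i. inv\<^bsub>A\<^esub> (x i)) [0..<k]"
    have q: "q \<in> lists (carrier A)" "length q = k"
      using mem by (auto simp: q_def)
    have "g = state_map M q"
      unfolding g by (rule eq[OF q x, symmetric]) (simp add: q_def mem)
    then show "g \<in> state_map M ` states M" using q by auto
  qed
qed

section \<open>Independence of the conjugates\<close>

text \<open>Each further factor \<open>1 - X ^ k\<close> moves the top block up by \<open>k\<close>
  places and negates it. Claiming only that coefficients are nontrivial keeps the sign out of the
  induction.\<close>

lemma T_pow_block:
  assumes x: "x \<in> carrier (direct_power A k)"
  shows "(\<forall>i \<ge> (n + 1) * k. T_pow (int n) (block k x) i = \<one>\<^bsub>A\<^esub>) \<and>
    (\<forall>j < k. x j \<noteq> \<one>\<^bsub>A\<^esub> \<longrightarrow> T_pow (int n) (block k x) (n * k + j) \<noteq> \<one>\<^bsub>A\<^esub>)"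
proof (induction n)
  case 0
  have "block k x \<in> carrier sequences" using x by (rule iota.hom_closed)
  then show ?case by (simp only: of_nat_0 T_pow_0) (simp add: block_def)
next
  case (Suc n)
  define y where "y = T_pow (int n) (block k x)"
  have bx: "block k x \<in> carrier sequences" using x by (rule iota.hom_closed)
  then have y: "y \<in> carrier sequences" unfolding y_def by (rule T_pow_closed)
  have Ty: "T_pow (int (Suc n)) (block k x) = difference k y"
    unfolding y_def using bx by (rule T_pow_Suc)
  have yi: "y i \<in> carrier A" for i
    using y by (simp add: carrier_sequences del: carrier_product_group)
  have d: "difference k y i = y i \<otimes>\<^bsub>A\<^esub> inv\<^bsub>A\<^esub> (y (i - k))" if "i \<ge> k" for i
    using that y by (simp add: difference_def del: carrier_product_group)
  have y1: "y i = \<one>\<^bsub>A\<^esub>" if "i \<ge> (n + 1) * k" for i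
    using Suc that by (simp add: y_def)
  show ?case
    unfolding Ty
  proof (intro conjI allI impI)
    fix i assume "i \<ge> (Suc n + 1) * k"
    then have "k \<le> i" "i \<ge> (n + 1) * k" "i - k \<ge> (n + 1) * k" by simp_all
    then show "difference k y i = \<one>\<^bsub>A\<^esub>" by (simp add: d y1)
  next
    fix j assume j: "j < k" "x j \<noteq> \<one>\<^bsub>A\<^esub>"
    then have "y (n * k + j) \<noteq> \<one>\<^bsub>A\<^esub>" using Suc by (simp add: y_def)
    \<comment> \<open>This place is beyond the degree of \<open>y\<close>, so only the delayed and
      negated coefficient of \<open>y\<close> at \<open>n * k + j\<close> survives.\<close>
    moreover have "y (Suc n * k + j) = \<one>\<^bsub>A\<^esub>" by (rule y1) simp
    ultimately show "difference k y (Suc n * k + j) \<noteq> \<one>\<^bsub>A\<^esub>"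
      using yi by (simp add: d)
  qed
qed

text \<open>Reading off one coefficient is a homomorphism; this reduces an equation between power
  series to one in \<open>A\<close>.\<close>

lemma finprod_sequences_nth:
  assumes "finite F" "\<And>i. i \<in> F \<Longrightarrow> g i \<in> carrier sequences"
  shows "finprod sequences g F j = finprod A (\<lambda>i. g i j) F"
  using assms
proof (induction F)
  case empty
  then show ?case by simp
next
  case (insert i F)
  then have "g l j \<in> carrier A" if "l \<in> insert i F" for l
    using that by (auto simp: carrier_sequences simp del: carrier_product_group)
  then show ?case
    using insert by (simp add: Pi_iff sequences_simps del: carrier_product_group mult_product_group)
qed

text \<open>After applying a power of \<open>T\<close> all exponents are nonnegative, and then the factor with the
  largest one is the only factor that is nontrivial on the last block.\<close>

lemma conj_prod_trivial:
  assumes f: "f \<in> carrier base" and one: "conj_prod f = \<one>\<^bsub>sequences\<^esub>"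
  shows "f = \<one>\<^bsub>base\<^esub>"
proof (rule ccontr)
  assume ne: "f \<noteq> \<one>\<^bsub>base\<^esub>"
  define F where "F = {i. f i \<noteq> \<one>\<^bsub>direct_power A k\<^esub>}"
  have "(\<forall>i. f i \<in> carrier (direct_power A k)) \<and> finite F"
    using f unfolding carrier_base F_def by (rule CollectD)
  then have mem: "f i \<in> carrier (direct_power A k)" and fin: "finite F" for i
    by blast+
  have "F \<noteq> {}"
  proof
    assume "F = {}"
    then have "f = (\<lambda>i. \<one>\<^bsub>direct_power A k\<^esub>)" unfolding F_def by blast
    then show False using ne by (simp add: restrict_def)
  qed
  define lo hi where "lo = Min F" and "hi = Max F"
  have hi: "hi \<in> F" "\<And>i. i \<in> F \<Longrightarrow> i \<le> hi" and lo: "\<And>i. i \<in> F \<Longrightarrow> lo \<le> i"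
    using fin \<open>F \<noteq> {}\<close> by (auto simp: lo_def hi_def)
  have "f hi \<noteq> \<one>\<^bsub>direct_power A k\<^esub>" using hi by (simp add: F_def)
  \<comment> \<open>Members of \<open>direct_power\<close> are extensional, so a nontrivial one is
    nontrivial at some index below \<open>k\<close>.\<close>
  moreover have "f hi = \<one>\<^bsub>direct_power A k\<^esub>" if "\<forall>j < k. f hi j = \<one>\<^bsub>A\<^esub>"
  proof (rule extensionalityI[of _ "{..<k}"])
    show "f hi \<in> extensional {..<k}" using mem[of hi] by (simp add: direct_power_def PiE_iff)
  qed (use that in \<open>simp_all add: direct_power_def\<close>)
  ultimately obtain j where j: "j < k" "f hi j \<noteq> \<one>\<^bsub>A\<^esub>" by blast
  have cl: "block k (f i) \<in> carrier sequences" for i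
    using mem by (rule iota.hom_closed)
  have "finprod sequences (\<lambda>i. T_pow (- lo) (T_pow i (block k (f i)))) F = T_pow (- lo) (conj_prod f)"
    unfolding conj_prod_def F_def[symmetric]
    by (rule T_pow_finprod[symmetric, OF fin]) (rule T_pow_closed[OF cl])
  also have "\<dots> = \<one>\<^bsub>sequences\<^esub>" unfolding one by (rule T_pow_one)
  finally have prod: "finprod sequences (\<lambda>i. T_pow (i - lo) (block k (f i))) F = \<one>\<^bsub>sequences\<^esub>"
    by (simp add: T_pow_add[OF cl, symmetric] del: one_product_group)
  \<comment> \<open>Place \<open>j\<close> of the block numbered \<open>hi - lo\<close>, the top
    block of the factor at \<open>hi\<close> after the shift by \<open>- lo\<close>.\<close>
  define l where "l = nat (hi - lo) * k + j"
  have g: "T_pow (i - lo) (block k (f i)) \<in> carrier sequences" for i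
    by (rule T_pow_closed[OF cl])
  then have gl: "T_pow (i - lo) (block k (f i)) l \<in> carrier A" for i
    by (auto simp: carrier_sequences simp del: carrier_product_group)
  have "\<one>\<^bsub>A\<^esub> = finprod A (\<lambda>i. T_pow (i - lo) (block k (f i)) l) F"
    using finprod_sequences_nth[where j = l and g = "\<lambda>i. T_pow (i - lo) (block k (f i))", OF fin g]
    unfolding prod by simp
  also have "\<dots> = finprod A (\<lambda>i. T_pow (i - lo) (block k (f i)) l) {hi}"
  proof (rule finprod_mono_neutral_cong_right[OF fin])
    show "T_pow (i - lo) (block k (f i)) l = \<one>\<^bsub>A\<^esub>" if "i \<in> F - {hi}" for i
    proof -
      have "i < hi" "lo \<le> i" using that hi(2)[of i] lo by auto
      \<comment> \<open>The factor at \<open>i < hi\<close> has degree below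
        \<open>(i - lo + 1) k\<close>, which is at most \<open>(hi - lo) k\<close> and hence at most
        \<open>l\<close>.\<close>
      then have "(nat (i - lo) + 1) * k \<le> nat (hi - lo) * k" by (intro mult_right_mono) auto
      then have "T_pow (int (nat (i - lo))) (block k (f i)) l = \<one>\<^bsub>A\<^esub>"
        by (intro T_pow_block[OF mem, THEN conjunct1, rule_format]) (simp add: l_def)
      then show ?thesis using \<open>lo \<le> i\<close> by simp
    qed
  qed (use hi gl in auto)
  also have "\<dots> = T_pow (hi - lo) (block k (f hi)) l"
    using gl by simp
  also have "\<dots> \<noteq> \<one>\<^bsub>A\<^esub>"
    using T_pow_block[OF mem[of hi], of "nat (hi - lo)"] j lo[OF hi(1)] by (simp add: l_def)
  finally show False by simp
qed

lemma automaton_group_iso: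
  assumes "carrier A \<noteq> {\<one>\<^bsub>A\<^esub>}"
  shows "automaton_group M \<cong> int_wreath (direct_power A k)"
proof -
  obtain a where a: "a \<in> carrier A" "a \<noteq> \<one>\<^bsub>A\<^esub>" using assms one_closed by blast
  have "(\<lambda>i\<in>{..<k}. a) \<in> carrier (direct_power A k)"
    using a by (simp add: direct_power_def)
  moreover have "(\<lambda>i\<in>{..<k}. a) \<noteq> \<one>\<^bsub>direct_power A k\<^esub>"
    using a k_pos by (auto simp: direct_power_def fun_eq_iff)
  ultimately have "carrier (direct_power A k) \<noteq> {\<one>\<^bsub>direct_power A k\<^esub>}" by blast
  from generate_iso_int_wreath[OF conj_prod_trivial this]
  show ?thesis by (simp only: automaton_group_def states_eq de_bruijn_mealy_simps(2))
qed

end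

theorem theorem5:
  fixes A :: "('a, 'b) monoid_scheme" and k :: nat
  assumes "comm_group A" and "finite (carrier A)" and "carrier A \<noteq> {\<one>\<^bsub>A\<^esub>}" and "k > 1"
  shows "automaton_group (de_bruijn_mealy k A) \<cong> int_wreath (direct_power A k)"
proof -
  interpret comm_group A by fact
  interpret de_bruijn_group A k
    by unfold_locales (use assms in simp)
  show ?thesis by (rule automaton_group_iso) fact
qed

end
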